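(* Let $(B_s)_{s\geq 0}$ be a standard one-dimensional Brownian motion with $B_0=0$ almost surely. Then for every fixed $t>0$ the random variable $$t^{-1}\int_0^t \mathbf 1_{(0,\infty)}(B_s)\,ds$$ has the arcsine distribution, i.e. its law is the probability measure on $\mathbb R$ that is absolutely continuous with respect to Lebesgue measure with density $$x\mapsto \frac{1}{\pi\sqrt{x(1-x)}}\,\mathbf 1_{(0,1)}(x).$$
   Context: $\mathbf 1_A(x)$ denotes the indicator of a set $A$, equal to $1$ if $x\in A$ and $0$ otherwise. The random variable is the proportion of time that the Brownian motion spends above zero during $[0,t]$. *)

theory Defs
  imports "HOL-Probability.Probability"
begin

text \<open>
  Only the variables \<open>B s\<close> with \<open>s \<ge> 0\<close> are constrained; the values at negative indices are
  irrelevant. Sample paths are required to be continuous almost surely, not surely.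
  Functionals of the whole path are therefore in general random variables only on the
  completion of \<open>M\<close>.
\<close>

locale standard_brownian_motion = prob_space M
  for M :: "'a measure" and B :: "real \<Rightarrow> 'a \<Rightarrow> real" +
  assumes random_variable: "\<And>s. 0 \<le> s \<Longrightarrow> B s \<in> borel_measurable M"
    and start_zero: "AE \<omega> in M. B 0 \<omega> = 0"
    and independent_increments:
      "\<And>(n::nat) (u :: nat \<Rightarrow> real). 0 \<le> u 0 \<Longrightarrow> strict_mono_on {..n} u \<Longrightarrow>
         indep_vars (\<lambda>_. borel) (\<lambda>i \<omega>. B (u (Suc i)) \<omega> - B (u i) \<omega>) {..<n}"
    and normal_increments:
      "\<And>r s. 0 \<le> r \<Longrightarrow> r < s \<Longrightarrow>
         distributed M lborel (\<lambda>\<omega>. B s \<omega> - B r \<omega>) (\<lambda>x. ennreal (normal_density 0 (sqrt (s - r)) x))"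
    and continuous_paths: "AE \<omega> in M. continuous_on {0..} (\<lambda>s. B s \<omega>)"

definition arcsine_density :: "real \<Rightarrow> real" where
  "arcsine_density x = 1 / (pi * sqrt (x * (1 - x))) * indicator {0<..<1} x"

end

theory Submission
  imports Defs
begin

text \<open>
  The occupation time is the limit of the fraction of positive values of \<open>B\<close> on the grid
  \<open>t k / n\<close>, because the zero set of a path is almost surely Lebesgue null. On the grid \<open>B\<close> is
  a random walk with symmetric diffuse steps. By Sparre Andersen's equivalence, its number of
  positive partial sums has the law of the index of its first maximum, which splits the walk into
  two independent pieces. So the probability of \<open>k\<close> positive sums among \<open>n\<close> is
  \<open>p k * p (n - k)\<close>, where \<open>p k\<close> is the probability that the first \<open>k\<close> sums are all positive. As
  these products sum to 1, the generating function of \<open>p\<close> is \<open>(1 - z) powr (- 1 / 2)\<close>, and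
  Vandermonde's identity gives the binomial moments \<open>p m * (n choose m)\<close>. In the limit the
  \<open>m\<close>-th moment is \<open>p m\<close>, which is that of the arcsine law; a law on a bounded interval is
  determined by its moments.
\<close>

subsection \<open>Sparre Andersen's theorem\<close>

definition walk :: "nat \<Rightarrow> (nat \<Rightarrow> real) \<Rightarrow> real" where
  "walk n x = (\<Sum>i<n. x i)"

primrec positives :: "nat \<Rightarrow> (nat \<Rightarrow> real) \<Rightarrow> nat" where
  "positives 0 x = 0"
| "positives (Suc n) x = positives n x + (if 0 < walk (Suc n) x then 1 else 0)"

text \<open>The strict comparison keeps the old index in a tie, so this is the smallest index in
  \<open>{0..n}\<close> at which the walk is maximal; the starting point 0 takes part.\<close>

primrec first_max :: "nat \<Rightarrow> (nat \<Rightarrow> real) \<Rightarrow> nat" where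
  "first_max 0 x = 0"
| "first_max (Suc n) x =
     (if walk (first_max n x) x < walk (Suc n) x then Suc n else first_max n x)"

text \<open>Cyclic shift of the first \<open>n + 1\<close> steps: step \<open>n\<close> comes first,
  the steps before it move back by one place.\<close>

definition rotate_steps :: "nat \<Rightarrow> (nat \<Rightarrow> real) \<Rightarrow> nat \<Rightarrow> real" where
  "rotate_steps n x i = (if i = 0 then x n else if i \<le> n then x (i - 1) else x i)"

lemma walk_0 [simp]: "walk 0 x = 0"
  by (simp add: walk_def)

lemma walk_Suc: "walk (Suc n) x = walk n x + x n"
  by (simp add: walk_def)

lemma walk_cong: "(\<And>i. i < n \<Longrightarrow> x i = y i) \<Longrightarrow> walk n x = walk n y"
  by (simp add: walk_def)

lemma walk_comb_seq_le: "k \<le> n \<Longrightarrow> walk k (comb_seq n x y) = walk k x"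
  by (intro walk_cong) (auto simp: comb_seq_def)

lemma walk_comb_seq_add: "walk (n + k) (comb_seq n x y) = walk n x + walk k y"
proof (induction k)
  case (Suc k)
  have "comb_seq n x y (n + k) = y k"
    by (simp add: comb_seq_def)
  with Suc show ?case by (simp add: walk_Suc)
qed (simp add: walk_comb_seq_le)

lemma walk_comb_seq_ge: "n \<le> k \<Longrightarrow> walk k (comb_seq n x y) = walk n x + walk (k - n) y"
  using walk_comb_seq_add[of n "k - n" x y] by simp

lemma walk_uminus: "walk n (\<lambda>i. - x i) = - walk n x"
  by (simp add: walk_def sum_negf)

lemma walk_rotate: "k \<le> n \<Longrightarrow> walk (Suc k) (rotate_steps n x) = x n + walk k x"
  by (induction k) (simp_all add: walk_Suc rotate_steps_def)

lemma positives_cong: "(\<And>k. k \<le> n \<Longrightarrow> walk k x = walk k y) \<Longrightarrow> positives n x = positives n y"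
  by (induction n) auto

lemma positives_le: "positives n x \<le> n"
  by (induction n) (auto intro: le_SucI)

lemma positives_eq_n_iff: "positives n x = n \<longleftrightarrow> (\<forall>k\<in>{1..n}. 0 < walk k x)"
proof (induction n)
  case (Suc n)
  then show ?case
    using positives_le[of n x] by (auto simp: atLeastAtMostSuc_conv)
qed simp

lemma positives_eq_0_iff: "positives n x = 0 \<longleftrightarrow> (\<forall>k\<in>{1..n}. walk k x \<le> 0)"
  by (induction n) (auto simp: atLeastAtMostSuc_conv)

lemma positives_eq_sum: "real (positives n x) = (\<Sum>k<n. indicator {0<..} (walk (Suc k) x))"
  by (induction n) auto

lemma first_max_spec:
  "first_max n x \<le> n \<and> (\<forall>j<first_max n x. walk j x < walk (first_max n x) x) \<and>
    (\<forall>j\<le>n. walk j x \<le> walk (first_max n x) x)"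
proof (induction n)
  case (Suc n)
  then show ?case
    by (auto simp: le_Suc_eq less_Suc_eq_le intro: order.strict_trans1 less_imp_le)
qed simp

text \<open>A strict bound to the left and a weak bound over the whole range can hold at one index
  only, so later proofs need not unfold the recursion.\<close>

lemma first_max_eq_iff:
  "first_max n x = k \<longleftrightarrow>
     k \<le> n \<and> (\<forall>j<k. walk j x < walk k x) \<and> (\<forall>j\<le>n. walk j x \<le> walk k x)"
  (is "?l \<longleftrightarrow> ?r")
proof
  assume ?r
  with first_max_spec[of n x] show ?l
    by (metis linorder_neqE_nat not_le)
qed (use first_max_spec in blast)

text \<open>Up to time \<open>k\<close> the conditions for a first maximum at \<open>k\<close>
  involve the first \<open>k\<close> steps only. After time \<open>k\<close> they compare with
  \<open>walk k x\<close>, hence say that the remaining steps never lead above 0.\<close>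

lemma first_max_comb_seq:
  assumes "k \<le> n"
  shows "first_max n (comb_seq k x y) = k \<longleftrightarrow> first_max k x = k \<and> first_max (n - k) y = 0"
proof -
  have "(\<forall>j\<le>n. walk j (comb_seq k x y) \<le> walk k x) \<longleftrightarrow>
        (\<forall>j\<le>k. walk j x \<le> walk k x) \<and> (\<forall>j\<le>n - k. walk j y \<le> 0)"
    (is "?l \<longleftrightarrow> ?r")
  proof
    assume l: ?l
    have "walk j x \<le> walk k x" if "j \<le> k" for j
      using l[rule_format, of j] that assms by (simp add: walk_comb_seq_le)
    moreover have "walk j y \<le> 0" if "j \<le> n - k" for j
      using l[rule_format, of "k + j"] that assms by (simp add: walk_comb_seq_add)
    ultimately show ?r by blast
  next
    assume r: ?r
    show ?l
    proof (intro allI impI)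
      fix j assume "j \<le> n"
      with r assms show "walk j (comb_seq k x y) \<le> walk k x"
        by (cases "j \<le> k") (auto simp: walk_comb_seq_le walk_comb_seq_ge)
    qed
  qed
  with assms show ?thesis
    by (auto simp: first_max_eq_iff walk_comb_seq_le)
qed

text \<open>The maximum is at least \<open>walk 0 x = 0\<close>, so a nonpositive new sum is no
  strict record.\<close>

lemma first_max_Suc_nonpos:
  assumes "walk (Suc n) x \<le> 0"
  shows "first_max (Suc n) x = first_max n x"
proof -
  have "walk 0 x \<le> walk (first_max n x) x"
    using first_max_spec[of n x] by blast
  with assms show ?thesis by simp
qed

text \<open>With step \<open>n\<close> in front, every old sum is raised by \<open>x n\<close> and
  its index by 1. The only new competitor is the value 0 at index 0; it loses because the raised
  maximum is at least the endpoint, which is positive.\<close>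

lemma first_max_rotate:
  assumes "0 < walk (Suc n) x"
  shows "first_max (Suc n) (rotate_steps n x) = Suc (first_max n x)"
proof -
  let ?k = "first_max n x"
  note spec = first_max_spec[of n x]
  have pos: "0 < x n + walk ?k x"
    using spec assms by (fastforce simp: walk_Suc)
  have S: "walk j (rotate_steps n x) = (case j of 0 \<Rightarrow> 0 | Suc i \<Rightarrow> x n + walk i x)" if "j \<le> Suc n" for j
    using that by (auto simp: walk_rotate split: nat.split)
  show ?thesis
    unfolding first_max_eq_iff using spec pos by (auto simp: S split: nat.splits)
qed

lemma walk_rotate_Suc: "walk (Suc n) (rotate_steps n x) = walk (Suc n) x"
  by (subst walk_rotate) (simp_all add: walk_Suc)

section \<open>Binomial identities for the exponent -1/2\<close>

text \<open>The numbers \<open>(- 1) ^ k * ((- 1 / 2) gchoose k)\<close> are the coefficients of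
  \<open>(1 - z) powr (- 1 / 2)\<close>. Trinomial revision pulls \<open>(- 1 / 2) gchoose m\<close>
  out of the sum, and Vandermonde evaluates what is left.\<close>

lemma sum_binomial_gbinomial_neg_half:
  "(\<Sum>k\<le>n. real (k choose m) *
     (((- 1) ^ k * ((- 1 / 2) gchoose k)) * ((- 1) ^ (n - k) * ((- 1 / 2) gchoose (n - k))))) =
   (- 1) ^ m * ((- 1 / 2) gchoose m) * real (n choose m)"
proof (cases "m \<le> n")
  case True
  let ?h = "- 1 / 2 :: real"
  have "(\<Sum>k\<le>n. real (k choose m) *
      (((- 1) ^ k * (?h gchoose k)) * ((- 1) ^ (n - k) * (?h gchoose (n - k))))) =
      (\<Sum>k\<in>{m..n}. (- 1) ^ n * ((?h gchoose k) * (real k gchoose m)) * (?h gchoose (n - k)))"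
  proof (rule sum.mono_neutral_cong_right)
    fix k assume "k \<in> {m..n}"
    then have "(- 1) ^ k * (- 1) ^ (n - k) = ((- 1) ^ n :: real)"
      by (simp flip: power_add)
    then show "real (k choose m) * (((- 1) ^ k * (?h gchoose k)) * ((- 1) ^ (n - k) * (?h gchoose (n - k)))) =
        (- 1) ^ n * ((?h gchoose k) * (real k gchoose m)) * (?h gchoose (n - k))"
      by (simp add: binomial_gbinomial[symmetric] mult_ac)
  qed (auto simp: binomial_eq_0)
  also have "\<dots> = (\<Sum>k\<in>{m..n}. (- 1) ^ n * (?h gchoose m) *
      ((?h - real m gchoose (k - m)) * (?h gchoose (n - k))))"
    by (intro sum.cong refl, subst gbinomial_trinomial_revision) simp_all
  also have "\<dots> = (\<Sum>k\<le>n - m. (- 1) ^ n * (?h gchoose m) *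
      ((?h - real m gchoose k) * (?h gchoose (n - m - k))))"
    by (rule sum.reindex_bij_witness[of _ "\<lambda>k. k + m" "\<lambda>k. k - m"]) (use True in auto)
  also have "\<dots> = (- 1) ^ n * (?h gchoose m) * (?h - real m + ?h gchoose (n - m))"
    by (simp only: sum_distrib_left[symmetric] gbinomial_Vandermonde[symmetric] atLeast0AtMost)
  also have "?h - real m + ?h = - (real m + 1)"
    by simp
  \<comment> \<open>Negating the upper index \<open>-(m + 1)\<close> turns it into
    \<open>(m + 1) + (n - m) - 1 = n\<close>.\<close>
  also have "(- (real m + 1) gchoose (n - m)) = (- 1) ^ (n - m) * (real n gchoose (n - m))"
    using True by (subst gbinomial_minus) (simp add: of_nat_diff)
  also have "(real n gchoose (n - m)) = real (n choose m)"
    using True by (simp add: binomial_symmetric[of m n] binomial_gbinomial)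
  also have "(- 1) ^ n * (?h gchoose m) * ((- 1) ^ (n - m) * real (n choose m)) =
      ((- 1) ^ (n + (n - m))) * (?h gchoose m) * real (n choose m)"
    by (simp add: power_add)
  also have "(- 1) ^ (n + (n - m)) = ((- 1) ^ m :: real)"
    using True by (auto simp: minus_one_power_iff)
  finally show ?thesis .
qed (auto simp: binomial_eq_0)

text \<open>In generating functions: the square of \<open>(1 - z) powr (- 1 / 2)\<close> is the
  geometric series.\<close>

lemma convolution_gbinomial_neg_half:
  "(\<Sum>k\<le>n. ((- 1) ^ k * ((- 1 / 2) gchoose k)) * ((- 1) ^ (n - k) * ((- 1 / 2) gchoose (n - k)))) = (1 :: real)"
  using sum_binomial_gbinomial_neg_half[of 0 n] by simp

text \<open>For positive \<open>n\<close> the two outer terms of the convolution are both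
  \<open>p 0 * p n\<close>, and the others involve earlier values only, so \<open>p n\<close> is
  determined recursively. The condition \<open>p 0 = 1\<close> selects the sign of the root.\<close>

lemma convolution_square_root_unique:
  fixes p :: "nat \<Rightarrow> real"
  assumes conv: "\<And>n. (\<Sum>k\<le>n. p k * p (n - k)) = 1" and p0: "p 0 = 1"
  shows "p n = (- 1) ^ n * ((- 1 / 2) gchoose n)"
proof (induction n rule: less_induct)
  case (less n)
  define c :: "nat \<Rightarrow> real" where "c n = (- 1) ^ n * ((- 1 / 2) gchoose n)" for n
  have c: "(\<Sum>k\<le>n. c k * c (n - k)) = 1"
    unfolding c_def by (rule convolution_gbinomial_neg_half)
  show ?case
  proof (cases n)
    case (Suc m)
    have split: "(\<Sum>k\<le>n. q k * q (n - k)) = 2 * q 0 * q n + (\<Sum>k\<in>{1..m}. q k * q (n - k))" for q :: "nat \<Rightarrow> real"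
    proof -
      have "{..n} = insert 0 (insert n {1..m})"
        using Suc by auto
      then show ?thesis
        using Suc by simp
    qed
    have "(\<Sum>k\<in>{1..m}. p k * p (n - k)) = (\<Sum>k\<in>{1..m}. c k * c (n - k))"
      using less Suc by (intro sum.cong) (auto simp: c_def)
    with split[of p] split[of c] conv[of n] c p0 have "p n = c n"
      by (simp add: c_def)
    then show ?thesis
      by (simp add: c_def)
  qed (simp add: p0)
qed

section \<open>Walks with independent symmetric diffuse steps\<close>

text \<open>The steps are the coordinates of the infinite product \<open>S\<close> of
  \<open>\<nu>\<close>. Symmetry permits reflection of the walk, and the absence of atoms makes
  vanishing partial sums negligible.\<close>

locale symmetric_walk = sequence_space \<nu> for \<nu> :: "real measure" +
  assumes sets_\<nu> [measurable_cong]: "sets \<nu> = sets borel"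
    and symmetric: "distr \<nu> borel uminus = \<nu>"
    and diffuse: "emeasure \<nu> {x} = 0"
begin

lemma space_\<nu> [simp]: "space \<nu> = UNIV"
  using sets_eq_imp_space_eq[OF sets_\<nu>] by simp

lemma space_S [simp]: "space S = UNIV"
  by (simp add: space_PiM)

lemma measurable_walk [measurable]: "walk n \<in> borel_measurable S"
  unfolding walk_def [abs_def] by measurable

lemma measurable_positives [measurable]: "positives n \<in> S \<rightarrow>\<^sub>M count_space UNIV"
  by (induction n) (simp_all del: One_nat_def)

lemma measurable_first_max [measurable]: "first_max n \<in> S \<rightarrow>\<^sub>M count_space UNIV"
proof (induction n)
  case (Suc n)
  note [measurable] = this
  \<comment> \<open>The time of evaluation is random, but it has countably many values.\<close>
  have [measurable]: "(\<lambda>x. walk (first_max n x) x) \<in> borel_measurable S"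
    by (rule measurable_compose_countable[where f=walk]) measurable
  show ?case by simp
qed simp

lemma measurable_rotate [measurable]: "rotate_steps n \<in> S \<rightarrow>\<^sub>M S"
  by (rule measurable_PiM_single') (auto simp: rotate_steps_def)

lemma sets_Collect_S: "Measurable.pred S P \<Longrightarrow> {x. P x} \<in> sets S"
  by (simp add: pred_def)

lemma measurable_level_sets [measurable]:
  "{x. positives n x = k} \<in> sets S"
  "{x. first_max n x = k} \<in> sets S"
  "{x. walk n x = a} \<in> sets S"
  "{x. \<forall>k\<in>{1..n}. walk k x < a} \<in> sets S"
  by (rule sets_Collect_S; measurable)+

text \<open>The first \<open>n\<close> steps are independent of the rest, and splicing two
  independent copies restores the law; then Fubini applies, with the first \<open>n\<close> steps
  inside.\<close>

lemma nn_integral_comb_seq: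
  assumes [measurable]: "f \<in> borel_measurable S"
  shows "(\<integral>\<^sup>+x. f x \<partial>S) = (\<integral>\<^sup>+y. \<integral>\<^sup>+x. f (comb_seq n x y) \<partial>S \<partial>S)"
proof -
  interpret SS: pair_sigma_finite S S ..
  have "(\<integral>\<^sup>+x. f x \<partial>S) = (\<integral>\<^sup>+z. f (comb_seq n (fst z) (snd z)) \<partial>(S \<Otimes>\<^sub>M S))"
    by (subst PiM_comb_seq[of n, symmetric], subst nn_integral_distr)
       (auto simp: split_beta')
  also have "\<dots> = (\<integral>\<^sup>+y. \<integral>\<^sup>+x. f (comb_seq n x y) \<partial>S \<partial>S)"
    by (subst SS.nn_integral_snd[symmetric]) auto
  finally show ?thesis .
qed

text \<open>Rotation reads the coordinates through an injective map of indices, which preserves a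
  product of equal factors.\<close>

lemma distr_rotate: "distr S S (rotate_steps n) = S"
proof -
  define p where "p i = (if i = 0 then n else if i \<le> n then i - 1 else i)" for i
  have "inj p"
    by (auto simp: inj_def p_def split: if_splits)
  then have "distr S S (\<lambda>\<omega>. \<lambda>i\<in>UNIV. \<omega> (p i)) = S"
    by (intro distr_PiM_reindex) (auto intro: M.prob_space_axioms)
  also have "(\<lambda>\<omega>. \<lambda>i\<in>UNIV. \<omega> (p i)) = rotate_steps n"
    by (auto simp: fun_eq_iff rotate_steps_def p_def)
  finally show ?thesis .
qed

lemma nn_integral_rotate:
  assumes [measurable]: "f \<in> borel_measurable S"
  shows "(\<integral>\<^sup>+x. f x \<partial>S) = (\<integral>\<^sup>+x. f (rotate_steps n x) \<partial>S)"
  by (subst distr_rotate[of n, symmetric], subst nn_integral_distr) auto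

text \<open>
  Sparre Andersen's equivalence, strengthened by the endpoint of the walk so that it can be
  proved by induction on \<open>n\<close>: adding a step increases the number of positive sums exactly when
  the new endpoint is positive. The index of the first maximum behaves in the same way if the
  new step is put at the end when the new endpoint is nonpositive and at the front otherwise,
  and rotating the steps changes neither their law nor the endpoint.
\<close>

lemma positives_first_max_equidistributed:
  assumes "f \<in> borel_measurable (count_space UNIV \<Otimes>\<^sub>M borel)"
  shows "(\<integral>\<^sup>+x. f (positives n x, walk n x) \<partial>S) = (\<integral>\<^sup>+x. f (first_max n x, walk n x) \<partial>S)"
  using assms
proof (induction n arbitrary: f)
  case (Suc n)
  note [measurable] = Suc.prems
  \<comment> \<open>The value of \<open>f\<close> after a step \<open>y\<close> from the sum
    \<open>s\<close>: the count grows exactly when the new endpoint is positive.\<close>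
  define h where "h k s y = (if 0 < s + y then f (Suc k, s + y) else f (k, s + y))"
    for k :: nat and s y :: real
  have [measurable]: "(\<lambda>z. h (fst z) (snd z) y) \<in> borel_measurable (count_space UNIV \<Otimes>\<^sub>M borel)" for y
    unfolding h_def by measurable
  have [measurable]: "(\<lambda>x. h (positives n x) (walk n x) (x n)) \<in> borel_measurable S"
     "(\<lambda>x. h (first_max n x) (walk n x) (x n)) \<in> borel_measurable S"
    unfolding h_def by measurable
  have N: "f (positives (Suc n) x, walk (Suc n) x) = h (positives n x) (walk n x) (x n)" for x
    by (simp add: h_def walk_Suc)
  have comb: "positives n (comb_seq n x y) = positives n x" "first_max n (comb_seq n x y) = first_max n x"
    for x y
     apply (rule positives_cong, simp add: walk_comb_seq_le)
    using first_max_spec[of n x] by (subst first_max_eq_iff) (auto simp: walk_comb_seq_le)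
  have "(\<integral>\<^sup>+x. f (positives (Suc n) x, walk (Suc n) x) \<partial>S) =
      (\<integral>\<^sup>+y. \<integral>\<^sup>+x. h (positives n x) (walk n x) (y 0) \<partial>S \<partial>S)"
    unfolding N by (subst nn_integral_comb_seq[of _ n])
      (simp_all add: comb walk_comb_seq_le, simp add: comb_seq_def)
  \<comment> \<open>The induction hypothesis is used for each fixed value of the new step
    \<open>y 0\<close>, which is step \<open>n\<close> of the spliced sequence.\<close>
  also have "\<dots> = (\<integral>\<^sup>+y. \<integral>\<^sup>+x. h (first_max n x) (walk n x) (y 0) \<partial>S \<partial>S)"
    using Suc.IH[of "\<lambda>z. h (fst z) (snd z) y" for y] by simp
  also have "\<dots> = (\<integral>\<^sup>+x. h (first_max n x) (walk n x) (x n) \<partial>S)"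
    by (subst (2) nn_integral_comb_seq[of _ n])
      (simp_all add: comb walk_comb_seq_le, simp add: comb_seq_def)
  \<comment> \<open>Split by the sign of the new endpoint: if it is positive, the first maximum is
    taken after rotation, otherwise the step is simply appended.\<close>
  also have "\<dots> = (\<integral>\<^sup>+x. (if 0 < walk (Suc n) x
      then f (first_max (Suc n) (rotate_steps n x), walk (Suc n) (rotate_steps n x)) else 0) +
      (if 0 < walk (Suc n) x then 0 else f (first_max (Suc n) x, walk (Suc n) x)) \<partial>S)"
    by (intro nn_integral_cong)
      (simp add: h_def first_max_rotate walk_rotate_Suc first_max_Suc_nonpos not_less
            flip: walk_Suc del: first_max.simps)
  also have "\<dots> = (\<integral>\<^sup>+x. (if 0 < walk (Suc n) x
      then f (first_max (Suc n) (rotate_steps n x), walk (Suc n) (rotate_steps n x)) else 0) \<partial>S) +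
      (\<integral>\<^sup>+x. (if 0 < walk (Suc n) x then 0 else f (first_max (Suc n) x, walk (Suc n) x)) \<partial>S)"
    by (intro nn_integral_add) measurable
  also have "(\<integral>\<^sup>+x. (if 0 < walk (Suc n) x
      then f (first_max (Suc n) (rotate_steps n x), walk (Suc n) (rotate_steps n x)) else 0) \<partial>S) =
      (\<integral>\<^sup>+x. (if 0 < walk (Suc n) x then f (first_max (Suc n) x, walk (Suc n) x) else 0) \<partial>S)"
    by (subst (2) nn_integral_rotate[of _ n]) (simp_all add: walk_rotate_Suc del: first_max.simps)
  also have "\<dots> + (\<integral>\<^sup>+x. (if 0 < walk (Suc n) x then 0 else f (first_max (Suc n) x, walk (Suc n) x)) \<partial>S) =
      (\<integral>\<^sup>+x. (if 0 < walk (Suc n) x then f (first_max (Suc n) x, walk (Suc n) x) else 0) +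
             (if 0 < walk (Suc n) x then 0 else f (first_max (Suc n) x, walk (Suc n) x)) \<partial>S)"
    by (intro nn_integral_add[symmetric]) measurable
  also have "\<dots> = (\<integral>\<^sup>+x. f (first_max (Suc n) x, walk (Suc n) x) \<partial>S)"
    by (intro nn_integral_cong) (auto simp del: first_max.simps)
  finally show ?case .
qed simp


lemma measure_positives_first_max:
  "measure S {x. positives n x = k} = measure S {x. first_max n x = k}"
proof -
  have "emeasure S {x. positives n x = k} = (\<integral>\<^sup>+x. indicator {x. positives n x = k} x \<partial>S)"
    by (rule nn_integral_indicator[symmetric]) measurable
  also have "\<dots> = (\<integral>\<^sup>+x. indicator ({k} \<times> UNIV) (positives n x, walk n x) \<partial>S)"
    by (intro nn_integral_cong) (simp add: indicator_def)
  also have "\<dots> = (\<integral>\<^sup>+x. indicator ({k} \<times> UNIV) (first_max n x, walk n x) \<partial>S)"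
    by (rule positives_first_max_equidistributed) measurable
  also have "\<dots> = (\<integral>\<^sup>+x. indicator {x. first_max n x = k} x \<partial>S)"
    by (intro nn_integral_cong) (simp add: indicator_def)
  also have "\<dots> = emeasure S {x. first_max n x = k}"
    by (rule nn_integral_indicator) measurable
  finally show ?thesis
    by (simp add: measure_def)
qed

text \<open>Cutting the walk at its first maximum leaves one condition on the first \<open>k\<close>
  steps and one on the later steps, and these are independent.\<close>

lemma measure_first_max:
  assumes "k \<le> n"
  shows "measure S {x. first_max n x = k} =
    measure S {x. first_max k x = k} * measure S {x. first_max (n - k) x = 0}"
proof -
  have "emeasure S {x. first_max n x = k} =
      (\<integral>\<^sup>+x. indicator {x. first_max n x = k} x \<partial>S)"
    by (rule nn_integral_indicator[symmetric]) measurable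
  also have "\<dots> = (\<integral>\<^sup>+y. \<integral>\<^sup>+x. indicator {x. first_max k x = k} x *
      indicator {y. first_max (n - k) y = 0} y \<partial>S \<partial>S)"
    by (subst nn_integral_comb_seq[of _ k])
      (auto intro!: nn_integral_cong simp: indicator_def first_max_comb_seq assms)
  also have "\<dots> = emeasure S {x. first_max k x = k} * emeasure S {x. first_max (n - k) x = 0}"
    by (simp add: nn_integral_multc nn_integral_cmult)
  finally show ?thesis
    by (simp add: measure_def enn2real_mult)
qed

text \<open>A product measure is determined by its values on cylinders; reflection sends a cylinder
  to a cylinder, and symmetry of \<open>\<nu>\<close> applies to each side.\<close>

lemma distr_uminus: "distr S S (\<lambda>x i. - x i) = S"
proof (rule PiM_eq)
  fix J and F :: "nat \<Rightarrow> real set"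
  assume J: "finite J" "J \<subseteq> UNIV" and F: "\<And>j. j \<in> J \<Longrightarrow> F j \<in> sets \<nu>"
  have [measurable]: "(\<lambda>x i. - x i) \<in> S \<rightarrow>\<^sub>M S"
    by (rule measurable_PiM_single') auto
  have F': "uminus -` F j \<in> sets \<nu>" if "j \<in> J" for j
    using measurable_sets[of uminus \<nu> borel "F j"] F[OF that] by (simp add: sets_\<nu>)
  have "emeasure (distr S S (\<lambda>x i. - x i)) (prod_emb UNIV (\<lambda>_. \<nu>) J (Pi\<^sub>E J F)) =
      emeasure S ((\<lambda>x i. - x i) -` prod_emb UNIV (\<lambda>_. \<nu>) J (Pi\<^sub>E J F) \<inter> space S)"
    using J F by (intro emeasure_distr sets_PiM_I) auto
  also have "(\<lambda>x i. - x i) -` prod_emb UNIV (\<lambda>_. \<nu>) J (Pi\<^sub>E J F) \<inter> space S =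
      prod_emb UNIV (\<lambda>_. \<nu>) J (\<Pi>\<^sub>E j\<in>J. uminus -` F j)"
    by (auto simp: prod_emb_def PiE_iff)
  also have "emeasure S \<dots> = (\<Prod>j\<in>J. emeasure \<nu> (uminus -` F j))"
    using J F' by (intro emeasure_PiM_emb) auto
  also have "\<dots> = (\<Prod>j\<in>J. emeasure \<nu> (F j))"
  proof (rule prod.cong)
    fix j assume "j \<in> J"
    then show "emeasure \<nu> (uminus -` F j) = emeasure \<nu> (F j)"
      using F[of j] by (subst (2) symmetric[symmetric], subst emeasure_distr) (auto simp: sets_\<nu>)
  qed simp
  finally show "emeasure (distr S S (\<lambda>x i. - x i)) (prod_emb UNIV (\<lambda>_. \<nu>) J (Pi\<^sub>E J F)) =
      (\<Prod>j\<in>J. emeasure \<nu> (F j))" .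
qed simp

text \<open>Given all steps but the first, a zero sum forces \<open>x 0\<close> to be a single
  point, which is null for a diffuse law.\<close>

lemma AE_walk_nonzero: "AE x in S. walk (Suc n) x \<noteq> 0"
proof (rule AE_I')
  have *: "walk (Suc n) (comb_seq 1 x y) = x 0 + walk n y" for x y
    by (subst walk_comb_seq_ge) (simp_all add: walk_def)
  have "emeasure S {x. walk (Suc n) x = 0} = (\<integral>\<^sup>+x. indicator {x. walk (Suc n) x = 0} x \<partial>S)"
    by (rule nn_integral_indicator[symmetric]) measurable
  also have "\<dots> = (\<integral>\<^sup>+y. \<integral>\<^sup>+x. indicator {x. walk (Suc n) x = 0} (comb_seq 1 x y) \<partial>S \<partial>S)"
    by (rule nn_integral_comb_seq) measurable
  also have "\<dots> = (\<integral>\<^sup>+y. \<integral>\<^sup>+x. indicator {x\<in>space S. x 0 \<in> {- walk n y}} x \<partial>S \<partial>S)"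
    by (intro nn_integral_cong) (auto simp only: * indicator_def mem_Collect_eq, auto)
  also have "\<dots> = (\<integral>\<^sup>+y. emeasure S {x\<in>space S. x 0 \<in> {- walk n y}} \<partial>S)"
    by (intro nn_integral_cong nn_integral_indicator) measurable
  also have "\<dots> = 0"
    by (subst emeasure_PiM_Collect_single) (auto simp: sets_\<nu> diffuse)
  finally show "{x. walk (Suc n) x = 0} \<in> null_sets S"
    by (auto intro!: null_setsI)
qed auto

text \<open>If no sum is positive, then almost surely all are negative, which is the mirror image of
  all being positive.\<close>

lemma measure_positives_symmetric:
  "measure S {x. positives n x = n} = measure S {x. positives n x = 0}"
proof -
  have [measurable]: "(\<lambda>x i. - x i) \<in> S \<rightarrow>\<^sub>M S"
    by (rule measurable_PiM_single') auto
  have "AE x in S. \<forall>k. walk (Suc k) x \<noteq> 0"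
    by (simp add: AE_all_countable AE_walk_nonzero)
  then have "AE x in S. x \<in> {x. positives n x = 0} \<longleftrightarrow> x \<in> {x. \<forall>k\<in>{1..n}. walk k x < 0}"
  proof eventually_elim
    case (elim x)
    then have "walk k x \<noteq> 0" if "k \<in> {1..n}" for k
      using that by (cases k) auto
    then show ?case
      by (force simp: positives_eq_0_iff order_less_le)
  qed
  then have "measure S {x. positives n x = 0} = measure S {x. \<forall>k\<in>{1..n}. walk k x < 0}"
    by (rule P.finite_measure_eq_AE) (rule measurable_level_sets)+
  also have "\<dots> = measure (distr S S (\<lambda>x i. - x i)) {x. \<forall>k\<in>{1..n}. walk k x < 0}"
    by (simp add: distr_uminus)
  also have "\<dots> = measure S {x. positives n x = n}"
    by (subst measure_distr) (auto simp: positives_eq_n_iff walk_uminus simp del: One_nat_def)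
  finally show ?thesis ..
qed

text \<open>The equivalence is used three times: for \<open>n\<close> to reach the first maximum
  and, after the cut, for \<open>k\<close> and \<open>n - k\<close> to return to positive sums.
  Reflection rewrites the last factor.\<close>

lemma measure_positives:
  assumes "k \<le> n"
  shows "measure S {x. positives n x = k} =
    measure S {x. positives k x = k} * measure S {x. positives (n - k) x = n - k}"
  by (simp only: measure_positives_symmetric[of "n - k"])
     (simp only: measure_positives_first_max measure_first_max[OF assms])

text \<open>Summing the product formula over \<open>k\<close> gives total probability 1, so these
  probabilities form a convolution square root of the constant sequence 1.\<close>

lemma measure_positives_all: "measure S {x. positives n x = n} = (- 1) ^ n * ((- 1 / 2) gchoose n)"
proof (rule convolution_square_root_unique)
  fix n
  have "(\<Sum>k\<le>n. measure S {x. positives k x = k} * measure S {x. positives (n - k) x = n - k}) =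
      (\<Sum>k\<le>n. measure S {x. positives n x = k})"
    by (intro sum.cong refl measure_positives[symmetric]) simp
  also have "\<dots> = measure S (\<Union>k\<le>n. {x. positives n x = k})"
    by (intro P.finite_measure_finite_Union[symmetric]) (auto simp: disjoint_family_on_def)
  also have "(\<Union>k\<le>n. {x. positives n x = k}) = space S"
    using positives_le[of n] by auto
  finally show "(\<Sum>k\<le>n. measure S {x. positives k x = k} * measure S {x. positives (n - k) x = n - k}) = 1"
    using P.prob_space by simp
qed (use P.prob_space in simp)

text \<open>Binomial moments are used because the product law sums against them in closed
  form.\<close>

lemma expectation_binomial_positives:
  "(\<integral>x. real (positives n x choose m) \<partial>S) = (- 1) ^ m * ((- 1 / 2) gchoose m) * real (n choose m)"
proof -
  have "(\<integral>x. real (positives n x choose m) \<partial>S) =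
      (\<integral>x. (\<Sum>k\<le>n. real (k choose m) * indicator {x. positives n x = k} x) \<partial>S)"
  proof (rule Bochner_Integration.integral_cong)
    fix x
    have "(\<Sum>k\<le>n. real (k choose m) * indicator {x. positives n x = k} x) =
        (\<Sum>k\<in>{positives n x}. real (k choose m))"
      using positives_le[of n x] by (intro sum.mono_neutral_cong_right) auto
    then show "real (positives n x choose m) =
        (\<Sum>k\<le>n. real (k choose m) * indicator {x. positives n x = k} x)"
      by simp
  qed simp
  also have "\<dots> = (\<Sum>k\<le>n. real (k choose m) * measure S {x. positives n x = k})"
    by (subst Bochner_Integration.integral_sum) (auto simp: P.emeasure_eq_measure)
  also have "\<dots> = (\<Sum>k\<le>n. real (k choose m) *
     (((- 1) ^ k * ((- 1 / 2) gchoose k)) * ((- 1) ^ (n - k) * ((- 1 / 2) gchoose (n - k)))))"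
    by (intro sum.cong refl, subst measure_positives) (simp_all only: measure_positives_all atMost_iff)
  also have "\<dots> = (- 1) ^ m * ((- 1 / 2) gchoose m) * real (n choose m)"
    by (rule sum_binomial_gbinomial_neg_half)
  finally show ?thesis .
qed

end

subsection \<open>Moments\<close>

lemma fact_times_binomial_eq_prod: "fact m * real (N choose m) = (\<Prod>i<m. real N - real i)"
  using gbinomial_mult_fact[of m "real N"] by (simp add: binomial_gbinomial atLeast0LessThan)

text \<open>The expression is the product of the \<open>m\<close> factors
  \<open>N n / n - i / n\<close>, each with limit \<open>a\<close>; thus scaled binomial moments
  turn into ordinary ones.\<close>

lemma tendsto_scaled_binomial:
  assumes "(\<lambda>n. real (N n) / real n) \<longlonglongrightarrow> a"
  shows "(\<lambda>n. fact m * real (N n choose m) / real n ^ m) \<longlonglongrightarrow> a ^ m"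
proof -
  have "(\<lambda>n. \<Prod>i<m. real (N n) / real n - real i * inverse (real n)) \<longlonglongrightarrow> (\<Prod>i<m. a - real i * 0)"
    by (intro tendsto_intros assms lim_inverse_n)
  also have "(\<lambda>n. \<Prod>i<m. real (N n) / real n - real i * inverse (real n)) =
      (\<lambda>n. fact m * real (N n choose m) / real n ^ m)"
    unfolding fact_times_binomial_eq_prod
    by (simp add: divide_inverse prod.distrib power_inverse flip: left_diff_distrib)
  finally show ?thesis by simp
qed

lemma scaled_binomial_le_1:
  assumes "N \<le> n" "0 < n"
  shows "fact m * real (N choose m) / real n ^ m \<le> 1"
proof -
  have "real ((N choose m) * fact m) \<le> real (n ^ m)"
    using binomial_fact_pow[of N m] power_mono[of N n m] assms by (intro of_nat_mono) linarith
  with assms show ?thesis by (simp add: divide_le_eq mult.commute)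
qed

text \<open>All absolute moments are at most 1, so the Taylor polynomials of the characteristic
  function, whose coefficients are given by the moments, have errors that vanish like
  \<open>\<bar>t\<bar> ^ n / fact n\<close>. Hence the characteristic functions agree.\<close>

lemma real_distribution_eqI_moments:
  assumes "real_distribution M1" "real_distribution M2"
    and bounded: "AE x in M1. \<bar>x\<bar> \<le> 1" "AE x in M2. \<bar>x\<bar> \<le> 1"
    and moments: "\<And>k. (\<integral>x. x ^ k \<partial>M1) = (\<integral>x. x ^ k \<partial>M2)"
  shows "M1 = M2"
proof (rule Levy_uniqueness)
  have approx: "cmod (char M t - (\<Sum>k\<le>n. ((\<i> * t) ^ k / fact k) * (\<integral>x. x ^ k \<partial>M))) \<le> 2 * (\<bar>t\<bar> ^ n / fact n)"
    if "real_distribution M" and bdd: "AE x in M. \<bar>x\<bar> \<le> 1" for M t n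
  proof -
    interpret real_distribution M by fact
    have int: "integrable M (\<lambda>x. x ^ k)" for k
      by (rule integrable_const_bound[where B=1]) (use bdd in \<open>auto simp: power_abs power_le_one\<close>)
    have "expectation (\<lambda>x. \<bar>x\<bar> ^ n) \<le> expectation (\<lambda>x. 1)"
      using integrable_abs[OF int[of n]] by (intro integral_mono_AE)
        (use bdd in \<open>auto simp: power_abs power_le_one\<close>)
    also have "\<dots> = 1"
      using prob_space by simp
    finally have "2 * \<bar>t\<bar> ^ n / fact n * expectation (\<lambda>x. \<bar>x\<bar> ^ n) \<le> 2 * \<bar>t\<bar> ^ n / fact n * 1"
      by (intro mult_left_mono) auto
    with char_approx1[of n t, OF int] show ?thesis by simp
  qed
  show "char M1 = char M2"
  proof
    fix t
    have "cmod (char M1 t - char M2 t) \<le> 4 * (\<bar>t\<bar> ^ n / fact n)" for n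
    proof -
      let ?s = "\<Sum>k\<le>n. ((\<i> * t) ^ k / fact k) * (\<integral>x. x ^ k \<partial>M2)"
      have "cmod (char M1 t - ?s) \<le> 2 * (\<bar>t\<bar> ^ n / fact n)"
        using approx[OF assms(1) bounded(1), of t n] by (simp only: moments)
      moreover have "cmod (?s - char M2 t) \<le> 2 * (\<bar>t\<bar> ^ n / fact n)"
        using approx[OF assms(2) bounded(2), of t n] by (simp only: norm_minus_commute)
      ultimately have "cmod (char M1 t - char M2 t) \<le> 2 * (\<bar>t\<bar> ^ n / fact n) + 2 * (\<bar>t\<bar> ^ n / fact n)"
        by (rule norm_diff_triangle_le)
      then show ?thesis by simp
    qed
    moreover have "(\<lambda>n. 4 * (\<bar>t\<bar> ^ n / fact n)) \<longlonglongrightarrow> 4 * 0"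
      using summable_LIMSEQ_zero[OF summable_exp[of "\<bar>t\<bar>"]]
      by (intro tendsto_intros) (simp add: divide_inverse mult.commute)
    ultimately have "cmod (char M1 t - char M2 t) \<le> 0"
      by (intro LIMSEQ_le_const[of _ "0"]) auto
    then show "char M1 t = char M2 t" by simp
  qed
qed fact+

section \<open>The arcsine law\<close>

lemma arcsine_density_nonneg: "0 \<le> arcsine_density x"
  by (auto simp: arcsine_density_def indicator_def)

lemma measurable_arcsine_density [measurable]: "arcsine_density \<in> borel_measurable borel"
  unfolding arcsine_density_def [abs_def] by measurable

text \<open>Both sides reduce to \<open>pi * pochhammer (1 / 2) m / fact m\<close>.\<close>

lemma Beta_half: "Beta (real m + 1 / 2) (1 / 2) = pi * ((- 1) ^ m * ((- 1 / 2) gchoose m))"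
proof -
  have "Gamma (1 / 2 + real m) = pochhammer (1 / 2) m * sqrt pi"
    by (subst pochhammer_Gamma) (auto simp: Gamma_one_half_real field_simps elim!: nonpos_Ints_cases)
  moreover have "(- 1 / 2 :: real) gchoose m = (- 1) ^ m * pochhammer (1 / 2) m / fact m"
    by (simp add: gbinomial_pochhammer)
  moreover have "Gamma (real m + 1 / 2 + 1 / 2) = fact m"
    by (simp add: Gamma_fact)
  ultimately show ?thesis
    by (simp add: Beta_def Gamma_one_half_real add.commute flip: power_mult_distrib)
qed

text \<open>Up to the factor \<open>1 / pi\<close> the integrand is that of the Beta integral with
  parameters \<open>m + 1 / 2\<close> and \<open>1 / 2\<close>. Being nonnegative, it may be treated
  by \<open>nn_integral\<close>, which gives integrability as well.\<close>

lemma has_bochner_integral_power_arcsine_density: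
  "has_bochner_integral lborel (\<lambda>x. x ^ m * arcsine_density x) ((- 1) ^ m * ((- 1 / 2) gchoose m))"
proof -
  have eq: "x ^ m * arcsine_density x =
      inverse pi * (indicator {0<..<1} x * (x powr ((real m + 1 / 2) - 1) * (1 - x) powr (1 / 2 - 1)))" for x
  proof (cases "x \<in> {0<..<1}")
    case True
    have "x powr ((real m + 1 / 2) - 1) = x powr (real m - 1 / 2)"
      by simp
    also have "\<dots> = x ^ m / sqrt x"
      using True by (simp only: powr_diff powr_half_sqrt powr_realpow greaterThanLessThan_iff less_imp_le)
    finally have a: "x powr ((real m + 1 / 2) - 1) = x ^ m / sqrt x" .
    have b: "(1 - x) powr (1 / 2 - 1) = inverse (sqrt (1 - x))"
      using True by (simp add: powr_half_sqrt powr_minus flip: powr_half_sqrt)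
    show ?thesis
      unfolding arcsine_density_def a b real_sqrt_mult using True by (simp add: divide_inverse mult_ac)
  qed (simp add: arcsine_density_def)
  have "((\<lambda>x. x powr ((real m + 1 / 2) - 1) * (1 - x) powr (1 / 2 - 1)) has_integral
      Beta (real m + 1 / 2) (1 / 2)) {0<..<1}"
    using has_integral_Beta_real[of "real m + 1 / 2" "1 / 2"] by (simp add: has_integral_Icc_iff_Ioo)
  then have "(\<integral>\<^sup>+x. indicator {0<..<1} x * (x powr ((real m + 1 / 2) - 1) * (1 - x) powr (1 / 2 - 1)) \<partial>lborel) =
      Beta (real m + 1 / 2) (1 / 2)"
    by (rule nn_integral_has_integral_lebesgue[rotated]) auto
  then have "(\<integral>\<^sup>+x. ennreal (x ^ m * arcsine_density x) \<partial>lborel) =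
      ennreal (inverse pi) * ennreal (Beta (real m + 1 / 2) (1 / 2))"
    unfolding eq by (subst ennreal_mult', simp, subst nn_integral_cmult) auto
  also have "\<dots> = ennreal (inverse pi * Beta (real m + 1 / 2) (1 / 2))"
    by (simp add: ennreal_mult')
  also have "\<dots> = ennreal ((- 1) ^ m * ((- 1 / 2) gchoose m))"
    by (simp add: Beta_half flip: mult.assoc)
  finally have "(\<integral>\<^sup>+x. ennreal (x ^ m * arcsine_density x) \<partial>lborel) =
      ennreal ((- 1) ^ m * ((- 1 / 2) gchoose m))" .
  moreover have "0 \<le> (- 1) ^ m * ((- 1 / 2 :: real) gchoose m)"
    by (simp add: gbinomial_pochhammer pochhammer_nonneg)
  moreover have "0 \<le> x ^ m * arcsine_density x" for x
    by (simp add: arcsine_density_def indicator_def)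
  ultimately show ?thesis
    by (intro has_bochner_integral_nn_integral) auto
qed

lemma arcsine_moment:
  "(\<integral>x. x ^ m \<partial>density lborel (\<lambda>x. ennreal (arcsine_density x))) = (- 1) ^ m * ((- 1 / 2) gchoose m)"
  using has_bochner_integral_power_arcsine_density[of m]
  by (subst integral_density)
     (auto simp: arcsine_density_nonneg mult.commute has_bochner_integral_iff)

lemma real_distribution_arcsine: "real_distribution (density lborel (\<lambda>x. ennreal (arcsine_density x)))"
proof (intro real_distribution.intro real_distribution_axioms.intro prob_spaceI)
  \<comment> \<open>The total mass is the moment of order 0.\<close>
  have "(\<integral>\<^sup>+x. ennreal (arcsine_density x) \<partial>lborel) = ennreal 1"
    using has_bochner_integral_power_arcsine_density[of 0]
    by (subst nn_integral_eq_integral) (auto simp: arcsine_density_nonneg has_bochner_integral_iff)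
  then show "emeasure (density lborel (\<lambda>x. ennreal (arcsine_density x)))
      (space (density lborel (\<lambda>x. ennreal (arcsine_density x)))) = 1"
    by (simp add: emeasure_density)
qed simp

lemma AE_arcsine: "AE x in density lborel (\<lambda>x. ennreal (arcsine_density x)). \<bar>x\<bar> \<le> 1"
  by (subst AE_density) (auto simp: arcsine_density_def indicator_def)

subsection \<open>Riemann sums for the occupation time\<close>

text \<open>The half-open cells partition \<open>{0<..t}\<close>, so at most one summand survives,
  and the ceiling finds the index of the right end of its cell.\<close>

lemma sum_grid_indicator:
  fixes t s :: real and g :: "nat \<Rightarrow> real"
  assumes "0 < t" "0 < n"
  shows "(\<Sum>k<n. indicator {real k * (t / real n)<..real (Suc k) * (t / real n)} s * g (Suc k)) =
    indicator {0<..t} s * g (nat \<lceil>s / (t / real n)\<rceil>)"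
proof -
  let ?h = "t / real n"
  have h: "0 < ?h" using assms by simp
  have iff: "s \<in> {real k * ?h<..real (Suc k) * ?h} \<longleftrightarrow> \<lceil>s / ?h\<rceil> = int (Suc k)" for k
    unfolding ceiling_eq_iff greaterThanAtMost_iff pos_less_divide_eq[OF h] pos_divide_le_eq[OF h] by simp
  have "(\<Sum>k<n. indicator {real k * ?h<..real (Suc k) * ?h} s * g (Suc k)) =
      (\<Sum>k<n. if \<lceil>s / ?h\<rceil> = int (Suc k) then g (Suc k) else 0)"
    by (intro sum.cong refl) (simp only: indicator_def iff, simp)
  also have "\<dots> = indicator {0<..t} s * g (nat \<lceil>s / ?h\<rceil>)"
  proof (cases "s \<in> {0<..t}")
    case True
    then have "0 < s" by simp
    then have "0 < s / ?h"
      using h by (rule divide_pos_pos)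
    then have "0 < \<lceil>s / ?h\<rceil>"
      by (simp only: zero_less_ceiling)
    moreover have "\<lceil>s / ?h\<rceil> \<le> int n"
      using True assms unfolding ceiling_le_iff by (simp add: field_simps)
    ultimately obtain k where k: "\<lceil>s / ?h\<rceil> = int (Suc k)" "k < n"
      by (metis Suc_le_eq gr0_conv_Suc of_nat_0_less_iff of_nat_le_iff pos_int_cases)
    have "(\<Sum>k<n. if \<lceil>s / ?h\<rceil> = int (Suc k) then g (Suc k) else 0) =
        (\<Sum>j<n. if j = k then g (Suc j) else 0)"
      using k by (intro sum.cong) auto
    then show ?thesis
      using True k(2) by (simp only: k(1) nat_int) simp
  next
    case False
    have "\<lceil>s / ?h\<rceil> \<noteq> int (Suc k)" if "k < n" for k
    proof
      assume "\<lceil>s / ?h\<rceil> = int (Suc k)"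
      then have "s \<in> {real k * ?h<..real (Suc k) * ?h}"
        by (simp only: iff)
      moreover have "real (Suc k) * ?h \<le> real n * ?h"
        using that h by (intro mult_right_mono) auto
      moreover have "0 \<le> real k * ?h"
        using h by (intro mult_nonneg_nonneg) auto
      moreover have "real n * ?h = t"
        using assms by simp
      ultimately have "s \<in> {0<..t}"
        unfolding greaterThanAtMost_iff by linarith
      with False show False ..
    qed
    then show ?thesis
      using False by simp
  qed
  finally show ?thesis .
qed

text \<open>The fraction is, up to scaling, the integral of a step function that copies the sign of
  \<open>b\<close> at the right end of each cell. Where \<open>b\<close> is nonzero its sign is
  locally constant, so dominated convergence applies.\<close>

lemma positive_fraction_tendsto_occupation:
  fixes b :: "real \<Rightarrow> real"
  assumes t: "0 < t" and cont: "continuous_on {0..} b"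
    and nz: "AE s in lborel. s \<in> {0..t} \<longrightarrow> b s \<noteq> 0"
  shows "(\<lambda>n. (\<Sum>k<n. indicator {0<..} (b (real (Suc k) * (t / real n)))) / real n) \<longlonglongrightarrow>
    inverse t * (LINT s:{0..t}|lborel. indicator {0<..} (b s))"
proof -
  define f :: "nat \<Rightarrow> real \<Rightarrow> real" where "f n s = (\<Sum>k<n. indicator {real k * (t / real n)<..real (Suc k) * (t / real n)} s *
    indicator {0<..} (b (real (Suc k) * (t / real n))))" for n s
  define F where "F s = indicator {0..t} s * (indicator {0<..} (b s) :: real)" for s
  \<comment> \<open>Continuity is known on the half-line only, so \<open>b\<close> is cut off first;
    outside \<open>{0..t}\<close> the product is 0, which does not count as positive.\<close>
  have F_eq: "F s = indicator {0<..} (indicator {0..t} s *\<^sub>R b s)" for s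
    by (simp add: F_def indicator_def)
  have "continuous_on {0..t} b"
    using cont by (rule continuous_on_subset) auto
  then have "(\<lambda>s. indicator {0..t} s *\<^sub>R b s) \<in> borel_measurable borel"
    by (intro borel_measurable_continuous_on_indicator) auto
  then have F_meas: "F \<in> borel_measurable lborel"
    unfolding F_eq [abs_def] by measurable
  have f_eq: "f n s = indicator {0<..t} s * indicator {0<..} (b (real (nat \<lceil>s / (t / real n)\<rceil>) * (t / real n)))"
    if "0 < n" for n s
    unfolding f_def using sum_grid_indicator[OF t that, of s "\<lambda>k. indicator {0<..} (b (real k * (t / real n)))"] .
  have "(\<lambda>n. LINT s|lborel. f n s) \<longlonglongrightarrow> (LINT s|lborel. F s)"
  proof (rule integral_dominated_convergence[where w="indicator {0..t}"])
    show "integrable lborel (indicat_real {0..t})"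
      by (subst integrable_indicator_iff) (use t in auto)
    show "AE s in lborel. (\<lambda>n. f n s) \<longlonglongrightarrow> F s"
      \<comment> \<open>The point 0 is set aside because the cells cover only
        \<open>{0<..t}\<close>.\<close>
      using nz AE_lborel_singleton[of 0]
    proof eventually_elim
      case (elim s)
      show ?case
      proof (cases "s \<in> {0<..t}")
        case True
        let ?r = "\<lambda>n. real (nat \<lceil>s / (t / real n)\<rceil>) * (t / real n)"
        have r: "s \<le> ?r n \<and> ?r n \<le> s + t / real n" if "0 < n" for n
        proof -
          have h: "0 < t / real n" using t that by simp
          have "0 \<le> s / (t / real n)"
            using True h by (intro divide_nonneg_pos) auto
          then have c: "real (nat \<lceil>s / (t / real n)\<rceil>) = of_int \<lceil>s / (t / real n)\<rceil>"
            by (intro of_nat_nat) (simp only: zero_le_ceiling)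
          have "s / (t / real n) * (t / real n) \<le> ?r n"
            unfolding c by (intro mult_right_mono le_of_int_ceiling less_imp_le[OF h])
          moreover have "?r n \<le> (s / (t / real n) + 1) * (t / real n)"
            unfolding c by (intro mult_right_mono of_int_ceiling_le_add_one less_imp_le[OF h])
          moreover have "s / (t / real n) * (t / real n) = s"
            using t that by simp
          ultimately show ?thesis
            by (simp only: distrib_right mult_1_left)
        qed
        have "(\<lambda>n. s + t * inverse (real n)) \<longlonglongrightarrow> s + t * 0"
          by (intro tendsto_intros lim_inverse_n)
        then have "(\<lambda>n. s + t / real n) \<longlonglongrightarrow> s"
          by (simp add: divide_inverse)
        then have "?r \<longlonglongrightarrow> s"
          using r by (intro tendsto_sandwich[of "\<lambda>_. s" ?r sequentially "\<lambda>n. s + t / real n"])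
            (auto intro: eventually_sequentiallyI[of 1])
        moreover have "isCont b s"
          using True by (intro continuous_on_interior[OF cont]) auto
        ultimately have lim: "(\<lambda>n. b (?r n)) \<longlonglongrightarrow> b s"
          by (rule isCont_tendsto_compose[rotated])
        \<comment> \<open>The indicator jumps at 0 only, and \<open>b s\<close> is nonzero
          here.\<close>
        have "\<forall>\<^sub>F n in sequentially. indicator {0<..} (b (?r n)) = (indicator {0<..} (b s) :: real)"
        proof (cases "0 < b s")
          case pos: True
          show ?thesis
            using order_tendstoD(1)[OF lim pos] by eventually_elim (use pos in auto)
        next
          case False
          then have neg: "b s < 0"
            using elim True by auto
          show ?thesis
            using order_tendstoD(2)[OF lim neg] by eventually_elim (use neg in auto)
        qed
        then have "\<forall>\<^sub>F n in sequentially. f n s = F s"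
          using eventually_gt_at_top[of 0] by eventually_elim (use True in \<open>simp add: f_eq F_def\<close>)
        then show ?thesis
          by (rule tendsto_eventually)
      next
        case False
        with elim have "F s = 0"
          by (auto simp: F_def indicator_def)
        moreover have "\<forall>\<^sub>F n in sequentially. f n s = 0"
          using eventually_gt_at_top[of 0] by eventually_elim (use False in \<open>simp add: f_eq\<close>)
        ultimately show ?thesis
          by (auto intro: tendsto_eventually)
      qed
    qed
    show "AE s in lborel. norm (f n s) \<le> indicator {0..t} s" for n
    proof (cases "n = 0")
      case False
      then show ?thesis by (auto simp: f_eq indicator_def)
    qed (auto simp: f_def)
    show "f n \<in> borel_measurable lborel" for n
      unfolding f_def [abs_def] by measurable
  qed (rule F_meas)
  moreover have "(LINT s|lborel. f n s) =
      (\<Sum>k<n. indicator {0<..} (b (real (Suc k) * (t / real n)))) * (t / real n)" for n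
  proof -
    have le: "real k * (t / real n) \<le> real (Suc k) * (t / real n)" for k
      using t by (intro mult_right_mono) auto
    have "(LINT s|lborel. f n s) =
        (\<Sum>k<n. (t / real n) * indicator {0<..} (b (real (Suc k) * (t / real n))))"
      unfolding f_def
    proof (subst Bochner_Integration.integral_sum)
      fix k
      show "integrable lborel (\<lambda>s. indicator {real k * (t / real n)<..real (Suc k) * (t / real n)} s *
          indicat_real {0<..} (b (real (Suc k) * (t / real n))))"
        using le[of k] by (intro integrable_mult_left integrable_real_indicator) simp_all
    next
      have "measure lborel {real k * (t / real n)<..real (Suc k) * (t / real n)} = t / real n" for k
        by (subst measure_lborel_Ioc[OF le])
          (simp flip: left_diff_distrib del: times_divide_eq_right)
      then show "(\<Sum>k<n. LINT s|lborel. indicator {real k * (t / real n)<..real (Suc k) * (t / real n)} s *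
          indicat_real {0<..} (b (real (Suc k) * (t / real n)))) =
          (\<Sum>k<n. (t / real n) * indicator {0<..} (b (real (Suc k) * (t / real n))))"
        by (simp del: of_nat_Suc)
    qed
    then show ?thesis
      by (simp only: sum_distrib_left[symmetric] mult.commute)
  qed
  ultimately have lim: "(\<lambda>n. inverse t * ((\<Sum>k<n. indicator {0<..} (b (real (Suc k) * (t / real n)))) * (t / real n)))
      \<longlonglongrightarrow> inverse t * (LINT s|lborel. F s)"
    by (intro tendsto_mult tendsto_const) simp
  have scale: "inverse t * (x * (t / real n)) = x / real n" for x n
    using t by (simp add: field_simps)
  show ?thesis
    using lim unfolding scale F_def set_lebesgue_integral_def real_scaleR_def .
qed

section \<open>Joint measurability and completion\<close>

text \<open>Rounding the time down to a multiple of \<open>1 / (n + 1)\<close> leaves countably many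
  times, so the rounded process is jointly measurable; by continuity it converges pointwise.\<close>

lemma measurable_continuous_process:
  fixes Y :: "real \<Rightarrow> 'a \<Rightarrow> real" and M :: "'a measure"
  assumes meas: "\<And>s. Y s \<in> borel_measurable M"
    and cont: "\<And>\<omega>. \<omega> \<in> space M \<Longrightarrow> continuous_on UNIV (\<lambda>s. Y s \<omega>)"
  shows "(\<lambda>z. Y (fst z) (snd z)) \<in> borel_measurable (borel \<Otimes>\<^sub>M M)"
proof (rule borel_measurable_LIMSEQ_real)
  note [measurable] = meas
  let ?r = "\<lambda>n s. of_int \<lfloor>s * real (Suc n)\<rfloor> / real (Suc n)"
  show "(\<lambda>z. Y (?r n (fst z)) (snd z)) \<in> borel_measurable (borel \<Otimes>\<^sub>M M)" for n
    by (rule measurable_compose_countable[where f="\<lambda>i z. Y (of_int i / real (Suc n)) (snd z)"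
        and g="\<lambda>z. \<lfloor>fst z * real (Suc n)\<rfloor>"]) measurable
  fix z :: "real \<times> 'a" assume "z \<in> space (borel \<Otimes>\<^sub>M M)"
  then have "isCont (\<lambda>s. Y s (snd z)) (fst z)"
    using cont[of "snd z"] by (auto simp: space_pair_measure continuous_on_eq_continuous_at)
  moreover have "(\<lambda>n. ?r n (fst z)) \<longlonglongrightarrow> fst z"
  proof (rule tendsto_sandwich)
    have "(\<lambda>n. fst z - inverse (real (Suc n))) \<longlonglongrightarrow> fst z - 0"
      by (intro tendsto_intros LIMSEQ_inverse_real_of_nat)
    then show "(\<lambda>n. fst z - inverse (real (Suc n))) \<longlonglongrightarrow> fst z" by simp
    show "\<forall>\<^sub>F n in sequentially. fst z - inverse (real (Suc n)) \<le> ?r n (fst z)"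
    proof (intro always_eventually allI)
      fix n
      have "fst z * real (Suc n) - 1 \<le> of_int \<lfloor>fst z * real (Suc n)\<rfloor>"
        by linarith
      then have "(fst z * real (Suc n) - 1) / real (Suc n) \<le> ?r n (fst z)"
        by (intro divide_right_mono) auto
      then show "fst z - inverse (real (Suc n)) \<le> ?r n (fst z)"
        by (simp add: diff_divide_distrib inverse_eq_divide)
    qed
    show "\<forall>\<^sub>F n in sequentially. ?r n (fst z) \<le> fst z"
      by (intro always_eventually allI) (simp add: pos_divide_le_eq)
  qed simp
  ultimately show "(\<lambda>n. Y (?r n (fst z)) (snd z)) \<longlonglongrightarrow> Y (fst z) (snd z)"
    by (rule isCont_tendsto_compose)
qed

text \<open>Preimages under \<open>X\<close> and \<open>X'\<close> differ by null sets, hence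
  \<open>X\<close> is measurable for the completion and has the same law.\<close>

lemma distributed_completionI:
  fixes X X' :: "'a \<Rightarrow> real"
  assumes X': "distributed M lborel X' f" and eq: "AE x in M. X x = X' x"
  shows "distributed (completion M) lborel X f"
proof -
  have [measurable]: "X' \<in> borel_measurable M" "f \<in> borel_measurable lborel"
    using X' by (auto simp: distributed_def)
  have X'_compl: "X' \<in> completion M \<rightarrow>\<^sub>M lborel"
    by (intro measurable_completion) simp
  have eq': "AE x in completion M. X x = X' x"
    using eq by (rule AE_completion)
  have "X \<in> completion M \<rightarrow>\<^sub>M lborel"
  proof (rule measurableI)
    fix A assume A: "A \<in> sets (lborel :: real measure)"
    have "X' -` A \<inter> space (completion M) \<in> sets (completion M)"
      using X'_compl A by (rule measurable_sets)
    moreover have "AE x in completion M.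
        x \<in> X' -` A \<inter> space (completion M) \<longleftrightarrow> x \<in> X -` A \<inter> space (completion M)"
      using eq' by eventually_elim auto
    ultimately show "X -` A \<inter> space (completion M) \<in> sets (completion M)"
      using completion.in_sets_AE Int_lower2 by blast
  qed simp
  moreover from this have "distr (completion M) lborel X = distr (completion M) lborel X'"
    using X'_compl eq' by (intro distr_cong_AE) auto
  moreover have "distr (completion M) lborel X' = distr M lborel X'"
    by (rule distr_completion) simp
  ultimately show ?thesis
    using X' by (simp add: distributed_def)
qed

subsection \<open>Brownian motion\<close>

text \<open>Symmetry is the affine rule for normal variables with factor -1; points are null since
  the law has a density.\<close>

lemma symmetric_walk_normal:
  assumes "0 < \<sigma>"
  shows "symmetric_walk (density lborel (\<lambda>x. ennreal (normal_density 0 \<sigma> x)))" (is "symmetric_walk ?\<nu>")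
proof -
  interpret prob_space ?\<nu>
    using assms by (rule prob_space_normal_density)
  have "distributed ?\<nu> lborel (\<lambda>x. x) (\<lambda>x. ennreal (normal_density 0 \<sigma> x))"
    by (simp add: distributed_def distr_id2)
  then have "distributed ?\<nu> lborel (\<lambda>x. 0 + (- 1) * x) (\<lambda>x. ennreal (normal_density (0 + (- 1) * 0) (\<bar>- 1\<bar> * \<sigma>) x))"
    using assms by (rule normal_density_affine) simp
  then have "distr ?\<nu> lborel uminus = ?\<nu>"
    by (simp add: distributed_def)
  moreover have "distr ?\<nu> lborel uminus = distr ?\<nu> borel uminus"
    by (rule distr_cong) simp_all
  moreover have "emeasure ?\<nu> {x} = 0" for x
  proof -
    have "{x} \<in> null_sets lborel"
      by (rule finite_imp_null_set_lborel) simp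
    moreover have "absolutely_continuous lborel ?\<nu>"
      by (rule absolutely_continuousI_density) measurable
    ultimately show ?thesis
      unfolding absolutely_continuous_def by (blast intro: null_setsD1)
  qed
  ultimately show ?thesis
    by unfold_locales auto
qed

text \<open>The bound \<open>k \<le> n\<close> keeps the index set of the product fixed during the
  induction.\<close>

lemma measurable_positives_PiM:
  "k \<le> n \<Longrightarrow> positives k \<in> (\<Pi>\<^sub>M i\<in>{..<n}. borel) \<rightarrow>\<^sub>M count_space UNIV"
proof (induction k)
  case (Suc k)
  then have [measurable]: "positives k \<in> (\<Pi>\<^sub>M i\<in>{..<n}. borel) \<rightarrow>\<^sub>M count_space UNIV"
    by simp
  have [measurable]: "walk (Suc k) \<in> borel_measurable (\<Pi>\<^sub>M i\<in>{..<n}. borel)"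
    unfolding walk_def [abs_def] using Suc.prems
    by (intro borel_measurable_sum measurable_component_singleton) auto
  show ?case by simp
next
  case 0
  have "positives 0 = (\<lambda>_. 0)"
    by (intro ext) simp
  then show ?case by simp
qed

context standard_brownian_motion
begin

definition increment :: "real \<Rightarrow> 'a \<Rightarrow> nat \<Rightarrow> real" where
  "increment h \<omega> i = B (real (Suc i) * h) \<omega> - B (real i * h) \<omega>"

lemma measurable_increment [measurable]:
  "0 \<le> h \<Longrightarrow> (\<lambda>\<omega>. increment h \<omega> i) \<in> borel_measurable M"
  unfolding increment_def by (intro borel_measurable_diff random_variable) auto

lemma walk_increment: "walk n (increment h \<omega>) = B (real n * h) \<omega> - B 0 \<omega>"
  by (induction n) (simp_all add: walk_Suc increment_def)

text \<open>Independence makes the joint law a product, and the equal spacing \<open>h\<close> makes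
  its factors equal.\<close>

lemma distr_increment:
  assumes h: "0 < h" and n: "0 < n"
  shows "distr M (\<Pi>\<^sub>M i\<in>{..<n}. borel) (\<lambda>\<omega>. \<lambda>i\<in>{..<n}. increment h \<omega> i) =
    (\<Pi>\<^sub>M i\<in>{..<n}. density lborel (\<lambda>x. ennreal (normal_density 0 (sqrt h) x)))"
proof -
  have "indep_vars (\<lambda>_. borel) (\<lambda>i \<omega>. increment h \<omega> i) {..<n}"
    unfolding increment_def using independent_increments[of "\<lambda>i. real i * h" n] h
    by (auto simp: strict_mono_on_def)
  then have "distr M (\<Pi>\<^sub>M i\<in>{..<n}. borel) (\<lambda>\<omega>. \<lambda>i\<in>{..<n}. increment h \<omega> i) =
      (\<Pi>\<^sub>M i\<in>{..<n}. distr M borel (\<lambda>\<omega>. increment h \<omega> i))"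
    using n h by (subst (asm) indep_vars_iff_distr_eq_PiM') auto
  also have "\<dots> = (\<Pi>\<^sub>M i\<in>{..<n}. density lborel (\<lambda>x. ennreal (normal_density 0 (sqrt h) x)))"
  proof (rule PiM_cong)
    fix i
    have "distributed M lborel (\<lambda>\<omega>. increment h \<omega> i)
        (\<lambda>x. ennreal (normal_density 0 (sqrt (real (Suc i) * h - real i * h)) x))"
      unfolding increment_def using h by (intro normal_increments) auto
    then have "distr M lborel (\<lambda>\<omega>. increment h \<omega> i) = density lborel (\<lambda>x. ennreal (normal_density 0 (sqrt h) x))"
      by (simp add: distributed_def algebra_simps)
    moreover have "distr M lborel (\<lambda>\<omega>. increment h \<omega> i) = distr M borel (\<lambda>\<omega>. increment h \<omega> i)"
      by (rule distr_cong) simp_all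
    ultimately show "distr M borel (\<lambda>\<omega>. increment h \<omega> i) =
        density lborel (\<lambda>x. ennreal (normal_density 0 (sqrt h) x))" by simp
  qed simp
  finally show ?thesis .
qed

lemma measurable_positives_increment [measurable]:
  assumes "0 \<le> h"
  shows "(\<lambda>\<omega>. positives n (increment h \<omega>)) \<in> M \<rightarrow>\<^sub>M count_space UNIV"
proof -
  have "(\<lambda>\<omega>. positives n (\<lambda>i\<in>{..<n}. increment h \<omega> i)) \<in> M \<rightarrow>\<^sub>M count_space UNIV"
    using assms by (intro measurable_compose[OF _ measurable_positives_PiM[of n n]] measurable_restrict) auto
  also have "(\<lambda>\<omega>. positives n (\<lambda>i\<in>{..<n}. increment h \<omega> i)) = (\<lambda>\<omega>. positives n (increment h \<omega>))"
    by (intro ext positives_cong walk_cong) auto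
  finally show ?thesis .
qed

lemma expectation_binomial_positives_increment:
  assumes h: "0 < h" and n: "0 < n"
  shows "expectation (\<lambda>\<omega>. real (positives n (increment h \<omega>) choose m)) =
    (- 1) ^ m * ((- 1 / 2) gchoose m) * real (n choose m)"
proof -
  let ?\<nu> = "density lborel (\<lambda>x. ennreal (normal_density 0 (sqrt h) x))"
  interpret W: symmetric_walk ?\<nu>
    using h by (intro symmetric_walk_normal) simp
  note [measurable] = measurable_positives_PiM[of n n, simplified]
  have restrict: "positives n (\<lambda>i\<in>{..<n}. x i) = positives n x" for x
    by (intro positives_cong walk_cong) auto
  have "expectation (\<lambda>\<omega>. real (positives n (increment h \<omega>) choose m)) =
      expectation (\<lambda>\<omega>. real (positives n (\<lambda>i\<in>{..<n}. increment h \<omega> i) choose m))"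
    by (simp only: restrict)
  also have "\<dots> = (\<integral>x. real (positives n x choose m) \<partial>(\<Pi>\<^sub>M i\<in>{..<n}. ?\<nu>))"
    unfolding distr_increment[OF h n, symmetric] using h
    by (subst integral_distr) (auto intro!: measurable_restrict)
  \<comment> \<open>The finite product is a projection of the sequence space, where the moments are
    known.\<close>
  also have "(\<Pi>\<^sub>M i\<in>{..<n}. ?\<nu>) = distr W.S (\<Pi>\<^sub>M i\<in>{..<n}. ?\<nu>) (\<lambda>x. \<lambda>i\<in>{..<n}. x i)"
    using distr_PiM_reindex[of UNIV "\<lambda>_. ?\<nu>" id "{..<n}"] W.M.prob_space_axioms by simp
  also have "(\<integral>x. real (positives n x choose m) \<partial>\<dots>) = (\<integral>x. real (positives n (\<lambda>i\<in>{..<n}. x i) choose m) \<partial>W.S)"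
  proof (rule integral_distr)
    show "(\<lambda>x. \<lambda>i\<in>{..<n}. x i) \<in> W.S \<rightarrow>\<^sub>M (\<Pi>\<^sub>M i\<in>{..<n}. ?\<nu>)"
      by (intro measurable_restrict measurable_component_singleton) simp
    have "sets (\<Pi>\<^sub>M i\<in>{..<n}. ?\<nu>) = sets (\<Pi>\<^sub>M i\<in>{..<n}. borel)"
      by (intro sets_PiM_cong) auto
    then have "borel_measurable (\<Pi>\<^sub>M i\<in>{..<n}. ?\<nu>) = borel_measurable (\<Pi>\<^sub>M i\<in>{..<n}. borel)"
      by (intro measurable_cong_sets) auto
    then show "(\<lambda>x. real (positives n x choose m)) \<in> borel_measurable (\<Pi>\<^sub>M i\<in>{..<n}. ?\<nu>)"
      by simp
  qed
  also have "\<dots> = (- 1) ^ m * ((- 1 / 2) gchoose m) * real (n choose m)"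
    unfolding restrict by (rule W.expectation_binomial_positives)
  finally show ?thesis .
qed

lemma AE_nonzero:
  assumes "0 < s"
  shows "AE \<omega> in M. B s \<omega> \<noteq> 0"
proof -
  have "distributed M lborel (\<lambda>\<omega>. B s \<omega> - B 0 \<omega>) (\<lambda>x. ennreal (normal_density 0 (sqrt (s - 0)) x))"
    using assms by (intro normal_increments) auto
  then have "(AE \<omega> in M. B s \<omega> - B 0 \<omega> \<noteq> 0) \<longleftrightarrow>
      (AE x in lborel. 0 < ennreal (normal_density 0 (sqrt (s - 0)) x) \<longrightarrow> x \<noteq> 0)"
    by (rule distributed_AE2[where P="\<lambda>x. x \<noteq> 0"]) measurable
  moreover have "AE x in lborel. x \<noteq> (0 :: real)"
    by (rule AE_lborel_singleton)
  ultimately have "AE \<omega> in M. B s \<omega> - B 0 \<omega> \<noteq> 0"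
    by auto
  with start_zero show ?thesis
    by eventually_elim simp
qed

text \<open>For each fixed positive time the path is almost surely nonzero; Fubini exchanges the two
  almost-everywhere quantifiers.\<close>

lemma AE_zero_set_null: "AE \<omega> in M. AE s in lborel. s \<in> {0..t} \<longrightarrow> B s \<omega> \<noteq> 0"
proof -
  obtain N where N: "{\<omega>\<in>space M. \<not> continuous_on {0..} (\<lambda>s. B s \<omega>)} \<subseteq> N" "N \<in> null_sets M"
    using continuous_paths by (auto elim: AE_E simp: null_sets_def)
  have N_sets [measurable]: "N \<in> sets M"
    using N by auto
  \<comment> \<open>Paths in the exceptional null set are replaced by 0 and negative times by time
    0, so every path of \<open>Y\<close> is continuous on the whole line, as joint measurability
    requires.\<close>
  define Y where "Y s \<omega> = indicator (space M - N) \<omega> * B (max 0 s) \<omega>" for s \<omega>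
  have Y: "(\<lambda>z. Y (fst z) (snd z)) \<in> borel_measurable (borel \<Otimes>\<^sub>M M)"
  proof (rule measurable_continuous_process)
    have [measurable]: "B (max 0 s) \<in> borel_measurable M" for s
      by (rule random_variable) simp
    show "Y s \<in> borel_measurable M" for s
      unfolding Y_def [abs_def] by measurable
    show "continuous_on UNIV (\<lambda>s. Y s \<omega>)" if "\<omega> \<in> space M" for \<omega>
    proof (cases "\<omega> \<in> N")
      case False
      with that N have "continuous_on {0..} (\<lambda>s. B s \<omega>)"
        by auto
      then have "continuous_on UNIV (\<lambda>s. B (max 0 s) \<omega>)"
        by (rule continuous_on_compose2) (auto intro!: continuous_intros)
      then show ?thesis
        using False that by (simp add: Y_def)
    qed (simp add: Y_def)
  qed
  interpret pair_sigma_finite lborel M ..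
  have notN: "AE \<omega> in M. \<omega> \<notin> N"
    using N by (intro AE_not_in)
  have [measurable]: "(\<lambda>z. Y (fst z) (snd z)) \<in> borel_measurable (lborel \<Otimes>\<^sub>M M)"
    using Y by (simp add: measurable_def space_pair_measure sets_pair_measure_cong[of lborel borel M M])
  \<comment> \<open>Points of \<open>N\<close> are excluded because \<open>Y\<close> vanishes
    there.\<close>
  have "AE s in lborel. AE \<omega> in M. s \<in> {0..t} \<and> \<omega> \<notin> N \<longrightarrow> Y s \<omega> \<noteq> 0"
    using AE_lborel_singleton[of 0]
  proof eventually_elim
    case (elim s)
    show ?case
    proof (cases "0 < s")
      case True
      from AE_nonzero[OF True] AE_space show ?thesis
        by eventually_elim (use True in \<open>auto simp: Y_def max_def\<close>)
    qed (use elim in auto)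
  qed
  then have "AE \<omega> in M. AE s in lborel. s \<in> {0..t} \<and> \<omega> \<notin> N \<longrightarrow> Y s \<omega> \<noteq> 0"
    by (subst (asm) AE_commute) measurable
  with notN AE_space show ?thesis
  proof eventually_elim
    case (elim \<omega>)
    from elim(3) show ?case
      by eventually_elim (use elim in \<open>auto simp: Y_def max_def\<close>)
  qed
qed


theorem occupation_time_arcsine:
  assumes t: "0 < t"
  shows "distributed (completion M) lborel
    (\<lambda>\<omega>. inverse t * (LINT s:{0..t}|lborel. indicator {0<..} (B s \<omega>)))
    (\<lambda>x. ennreal (arcsine_density x))"
proof (rule distributed_completionI)
  let ?A = "\<lambda>\<omega>. inverse t * (LINT s:{0..t}|lborel. indicat_real {0<..} (B s \<omega>))"
  define N where "N n \<omega> = positives n (increment (t / real n) \<omega>)" for n \<omega>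
  \<comment> \<open>A version of the occupation fraction that is measurable on \<open>M\<close>
    itself; its law is computed first and then carried to the completion.\<close>
  define X where "X \<omega> = lim (\<lambda>n. real (N n \<omega>) / real n)" for \<omega>
  have N_meas [measurable]: "N n \<in> M \<rightarrow>\<^sub>M count_space UNIV" for n
    unfolding N_def [abs_def] using t by (intro measurable_positives_increment) simp
  have X_meas [measurable]: "X \<in> borel_measurable M"
    unfolding X_def [abs_def] by measurable
  have lim_A: "AE \<omega> in M. (\<lambda>n. real (N n \<omega>) / real n) \<longlonglongrightarrow> ?A \<omega>"
    using start_zero continuous_paths AE_zero_set_null[of t]
  proof eventually_elim
    case (elim \<omega>)
    have "real (N n \<omega>) = (\<Sum>k<n. indicator {0<..} (B (real (Suc k) * (t / real n)) \<omega>))" for n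
      unfolding N_def positives_eq_sum walk_increment elim by simp
    then show ?case
      using positive_fraction_tendsto_occupation[OF t elim(2,3)] by simp
  qed
  then show eq: "AE \<omega> in M. ?A \<omega> = X \<omega>"
    by eventually_elim (simp add: X_def limI)
  have lim: "AE \<omega> in M. (\<lambda>n. real (N n \<omega>) / real n) \<longlonglongrightarrow> X \<omega>"
    using lim_A eq by eventually_elim simp
  have N_le: "N n \<omega> \<le> n" for n \<omega>
    by (simp add: N_def positives_le)
  have X_bounded: "AE \<omega> in M. \<bar>X \<omega>\<bar> \<le> 1"
    using lim
  proof eventually_elim
    case (elim \<omega>)
    have "\<bar>real (N n \<omega>) / real n\<bar> \<le> 1" for n
      using N_le[of n \<omega>] by (cases "n = 0") auto
    then show ?case
      by (intro LIMSEQ_le_const2[OF tendsto_rabs[OF elim]]) auto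
  qed
  have moment: "expectation (\<lambda>\<omega>. X \<omega> ^ m) = (- 1) ^ m * ((- 1 / 2) gchoose m)" for m
  proof -
    have "(\<lambda>n. expectation (\<lambda>\<omega>. fact m * real (N n \<omega> choose m) / real n ^ m)) \<longlonglongrightarrow>
        expectation (\<lambda>\<omega>. X \<omega> ^ m)"
    \<comment> \<open>For positive \<open>n\<close> the integrand is at most 1; the case
      \<open>n = 0\<close> is checked apart, where for positive \<open>m\<close> division by
      \<open>0 ^ m\<close> gives 0.\<close>
    proof (rule integral_dominated_convergence[where w="\<lambda>_. 1 + fact m"])
      show "AE \<omega> in M. (\<lambda>n. fact m * real (N n \<omega> choose m) / real n ^ m) \<longlonglongrightarrow> X \<omega> ^ m"
        using lim by eventually_elim (rule tendsto_scaled_binomial)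
      show "AE \<omega> in M. norm (fact m * real (N n \<omega> choose m) / real n ^ m) \<le> 1 + fact m" for n
      proof (cases "n = 0")
        case True
        then show ?thesis
          using N_le[of 0] by (cases m) auto
      next
        case False
        have "norm (fact m * real (N n \<omega> choose m) / real n ^ m) \<le> 1" for \<omega>
          using scaled_binomial_le_1[OF N_le[of n \<omega>], where m=m] False by simp
        also have "1 \<le> 1 + (fact m :: real)"
          by simp
        finally show ?thesis
          by (intro AE_I2)
      qed
    qed measurable
    moreover have "\<forall>\<^sub>F n in sequentially.
        expectation (\<lambda>\<omega>. fact m * real (N n \<omega> choose m) / real n ^ m) =
        (- 1) ^ m * ((- 1 / 2) gchoose m) * (fact m * real (n choose m) / real n ^ m)"
      using eventually_gt_at_top[of 0]
    proof eventually_elim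
      case (elim n)
      have "expectation (\<lambda>\<omega>. real (N n \<omega> choose m)) = (- 1) ^ m * ((- 1 / 2) gchoose m) * real (n choose m)"
        unfolding N_def using elim t by (intro expectation_binomial_positives_increment) auto
      then show ?case by simp
    qed
    ultimately have "(\<lambda>n. (- 1) ^ m * ((- 1 / 2) gchoose m) * (fact m * real (n choose m) / real n ^ m)) \<longlonglongrightarrow>
        expectation (\<lambda>\<omega>. X \<omega> ^ m)"
      by (rule Lim_transform_eventually)
    \<comment> \<open>The same limit as for \<open>N n\<close>, now for \<open>n\<close> itself: the
      deterministic factor tends to 1.\<close>
    moreover have "(\<lambda>n. real n / real n) \<longlonglongrightarrow> 1"
      by (rule tendsto_eventually) (use eventually_gt_at_top[of 0] in \<open>eventually_elim, simp\<close>)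
    then have "(\<lambda>n. (- 1) ^ m * ((- 1 / 2) gchoose m) * (fact m * real (n choose m) / real n ^ m)) \<longlonglongrightarrow>
        (- 1) ^ m * ((- 1 / 2 :: real) gchoose m) * 1 ^ m"
      by (intro tendsto_mult tendsto_const tendsto_scaled_binomial)
    ultimately show ?thesis
      using LIMSEQ_unique by fastforce
  qed
  have "distr M borel X = density lborel (\<lambda>x. ennreal (arcsine_density x))"
  proof (rule real_distribution_eqI_moments)
    show "real_distribution (distr M borel X)"
      by (rule real_distribution_distr) simp
    show "AE x in distr M borel X. \<bar>x\<bar> \<le> 1"
      using X_bounded by (subst AE_distr_iff) auto
    show "(\<integral>x. x ^ k \<partial>distr M borel X) = (\<integral>x. x ^ k \<partial>density lborel (\<lambda>x. ennreal (arcsine_density x)))" for k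
      unfolding arcsine_moment by (subst integral_distr) (auto simp: moment)
  qed (rule real_distribution_arcsine AE_arcsine)+
  moreover have "distr M lborel X = distr M borel X"
    by (rule distr_cong) simp_all
  ultimately show "distributed M lborel X (\<lambda>x. ennreal (arcsine_density x))"
    by (simp add: distributed_def)
qed

end

theorem theorem1:
  fixes M :: "'a measure" and B :: "real \<Rightarrow> 'a \<Rightarrow> real" and t :: real
  assumes "standard_brownian_motion M B"
    and "t > 0"
  shows "distributed (completion M) lborel
           (\<lambda>\<omega>. inverse t * (LINT s:{0..t}|lborel. indicator {0<..} (B s \<omega>)))
           (\<lambda>x. ennreal (arcsine_density x))"
  using assms by (rule standard_brownian_motion.occupation_time_arcsine)

end
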